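(* Let $a,b\geq 0$ and $c,d\geq 1$ be integers, let $v=a+b+c+d+1$, and let $L=\{1^a,2^b,3^c,4^d\}$ be an admissible list. If $a\geq 3$, or if $a=2$ and $b\geq 1$, then there exists a Hamiltonian path $H$ of $K_v$ with $\ell(H)=L$.
   Context: $K_v$ is the complete graph on vertex set $\{0,1,\ldots,v-1\}$. The length of an edge $[x,y]$ is $\min(|x-y|,\,v-|x-y|)$, and for a subgraph $H$, $\ell(H)$ is the list (multiset) of lengths of its edges. The notation $\{1^{a_1},\ldots,t^{a_t}\}$ denotes the multiset containing $a_i$ copies of $i$. A list $L$ of $v-1$ positive integers not exceeding $\lfloor v/2\rfloor$ is called admissible if for every divisor $d$ of $v$, the number of elements of $L$ (with multiplicity) that are multiples of $d$ is at most $v-d$. *)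

theory Defs
  imports Main "HOL-Library.Multiset"
begin

type_synonym edge = "nat set"

definition complete_vertices :: "nat \<Rightarrow> nat set" where
  "complete_vertices v = {..<v}"

definition complete_edges :: "nat \<Rightarrow> edge set" where
  "complete_edges v = {{x, y} | x y. x < v \<and> y < v \<and> x \<noteq> y}"

text \<open>For an edge \<open>e = {x, y}\<close>, the difference \<open>Max e - Min e\<close> is \<open>|x - y|\<close>;
  see \<open>edge_length_insert\<close>.\<close>

definition edge_length :: "nat \<Rightarrow> edge \<Rightarrow> nat" where
  "edge_length v e = min (Max e - Min e) (v - (Max e - Min e))"

lemma edge_length_insert:
  assumes "x < v" and "y < v"
  shows "int (edge_length v {x, y}) = min \<bar>int x - int y\<bar> (int v - \<bar>int x - int y\<bar>)"
  using assms by (cases "x \<le> y") (auto simp: edge_length_def max_def min_def)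

definition lengths :: "nat \<Rightarrow> edge set \<Rightarrow> nat multiset" where
  "lengths v F = image_mset (edge_length v) (mset_set F)"

text \<open>A path is given by the sequence of its vertices; as a subgraph it has the edges below.\<close>

definition path_edges :: "nat list \<Rightarrow> edge set" where
  "path_edges p = {{p ! i, p ! Suc i} | i. Suc i < length p}"

definition hamiltonian_path :: "nat set \<Rightarrow> edge set \<Rightarrow> nat list \<Rightarrow> bool" where
  "hamiltonian_path V E p \<longleftrightarrow> distinct p \<and> set p = V \<and> path_edges p \<subseteq> E"

definition admissible :: "nat \<Rightarrow> nat multiset \<Rightarrow> bool" where
  "admissible v L \<longleftrightarrow>
     size L = v - 1 \<and>
     (\<forall>x \<in># L. 1 \<le> x \<and> x \<le> v div 2) \<and>
     (\<forall>k. k dvd v \<longrightarrow> size {#x \<in># L. k dvd x#} \<le> v - k)"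

end

theory Submission
  imports Defs
begin

text \<open>
  It suffices to find a permutation of \<open>{0..<v}\<close> whose consecutive absolute differences form \<open>L\<close>:
  since \<open>v \<ge> 8\<close>, differences up to 4 are also cyclic lengths.  Such a permutation can be grown at a
  cut \<open>m\<close> if the edges between \<open>{..<m}\<close> and \<open>{m..}\<close> have pairwise distinct lower ends and
  these are exactly \<open>m - x, \<dots>, m - 1\<close>.  Shifting all vertices \<open>\<ge> m\<close> up by \<open>x\<close> and routing each crossing
  edge \<open>{l, r}\<close> as \<open>l, l + x, r + x\<close> fills the gap, keeps all old differences and adds \<open>x\<close> copies
  of \<open>x\<close>; moreover cuts survive.  Hence finitely many seed permutations, found by computer search,
  yield all lists \<open>{1^a, 2^b, 3^c, 4^d}\<close>.
\<close>

subsection \<open>Consecutive differences and growing\<close>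

definition absdiff :: "nat \<Rightarrow> nat \<Rightarrow> nat" where
  "absdiff y z = (y - z) + (z - y)"

fun diffs :: "nat list \<Rightarrow> nat list" where
  "diffs (y # z # p) = absdiff y z # diffs (z # p)"
| "diffs _ = []"

text \<open>Repetitions are kept, so that comparing multisets later also forces distinct lower
  ends.\<close>

fun crossing_lows :: "nat \<Rightarrow> nat list \<Rightarrow> nat list" where
  "crossing_lows m (y # z # p) =
     (if (y < m) = (z < m) then crossing_lows m (z # p) else min y z # crossing_lows m (z # p))"
| "crossing_lows m _ = []"

definition shift_from :: "nat \<Rightarrow> nat \<Rightarrow> nat \<Rightarrow> nat" where
  "shift_from m x y = (if y < m then y else y + x)"

fun grow :: "nat \<Rightarrow> nat \<Rightarrow> nat list \<Rightarrow> nat list" where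
  "grow m x (y # z # p) =
     (if (y < m) = (z < m) then shift_from m x y # grow m x (z # p)
      else shift_from m x y # (min y z + x) # grow m x (z # p))"
| "grow m x [y] = [shift_from m x y]"
| "grow m x [] = []"

lemma grow_Cons: "\<exists>q. grow m x (z # p) = shift_from m x z # q"
  by (cases p) auto

lemma mset_grow:
  "mset (grow m x p) =
     image_mset (shift_from m x) (mset p) + image_mset (\<lambda>y. y + x) (mset (crossing_lows m p))"
  by (induction m x p rule: grow.induct) auto

text \<open>Edges on one side of the cut move rigidly; a crossing edge with ends
  \<open>l < r\<close> turns into the differences \<open>x\<close> and \<open>r - l\<close>, in the
  order given by the direction of traversal.\<close>

lemma mset_diffs_grow:
  "mset (diffs (grow m x p)) = mset (diffs p) + replicate_mset (length (crossing_lows m p)) x"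
proof (induction m x p rule: grow.induct)
  case (1 m x y z p)
  obtain q where q: "grow m x (z # p) = shift_from m x z # q"
    using grow_Cons by blast
  show ?case
    using 1 by (auto simp: q shift_from_def absdiff_def min_def)
qed auto

text \<open>The hypothesis puts each inserted vertex \<open>l + x\<close> at or above
  \<open>m\<close>. So of the two edges replacing \<open>{l, r}\<close> only
  \<open>{l, l + x}\<close> can cross at \<open>m'\<close>; it does so exactly when
  \<open>{l, r}\<close> did, with the same lower end.\<close>

lemma crossing_lows_grow_below:
  assumes "m' \<le> m" and "\<forall>y \<in> set (crossing_lows m p). m \<le> y + x"
  shows "crossing_lows m' (grow m x p) = crossing_lows m' p"
  using assms
proof (induction m x p rule: grow.induct)
  case (1 m x y z p)
  obtain q where q: "grow m x (z # p) = shift_from m x z # q"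
    using grow_Cons by blast
  show ?case
    using 1 by (auto simp: q shift_from_def min_def split: if_splits)
qed auto

text \<open>Here \<open>l + x\<close> lies below \<open>m' + x\<close>, so \<open>{l, l + x}\<close>
  does not cross, and \<open>{l + x, r + x}\<close> crosses exactly when \<open>{l, r}\<close>
  crosses at \<open>m'\<close>.\<close>

lemma crossing_lows_grow_above:
  assumes "m \<le> m'"
  shows "crossing_lows (m' + x) (grow m x p) = map (\<lambda>y. y + x) (crossing_lows m' p)"
  using assms
proof (induction m x p rule: grow.induct)
  case (1 m x y z p)
  obtain q where q: "grow m x (z # p) = shift_from m x z # q"
    using grow_Cons by blast
  show ?case
    using 1 by (cases "y < m"; cases "z < m") (auto simp: q shift_from_def min_def)
qed auto

text \<open>The condition \<open>x \<le> m\<close> keeps \<open>m - x\<close> from truncating, so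
  there are exactly \<open>x\<close> crossing edges.\<close>

definition growable_at :: "nat \<Rightarrow> nat \<Rightarrow> nat list \<Rightarrow> bool" where
  "growable_at m x p \<longleftrightarrow>
     x \<le> m \<and> m \<le> length p \<and> mset (crossing_lows m p) = mset [m - x..<m]"

definition growable :: "nat \<Rightarrow> nat list \<Rightarrow> bool" where
  "growable x p \<longleftrightarrow> (\<exists>m. growable_at m x p)"

lemma map_add_const_upt: "map (\<lambda>y. y + x) [i..<j] = [i + x..<j + x]"
  by (induction j) auto

lemma upt_split: "i \<le> j \<Longrightarrow> j \<le> k \<Longrightarrow> [i..<k] = [i..<j] @ [j..<k]"
  by (metis le_add_diff_inverse upt_add_eq_append)

lemma length_grow:
  assumes "growable_at m x p"
  shows "length (grow m x p) = length p + x"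
proof -
  have "length (crossing_lows m p) = x"
    using assms mset_eq_length[of "crossing_lows m p" "[m - x..<m]"]
    by (simp add: growable_at_def)
  then show ?thesis
    using arg_cong[OF mset_grow[of m x p], of size] by simp
qed

lemma growable_grow:
  assumes cut: "growable_at m x p" and "growable x' p"
  shows "growable x' (grow m x p)"
proof -
  obtain m' where m': "growable_at m' x' p"
    using assms(2) by (auto simp: growable_def)
  have len: "length (grow m x p) = length p + x"
    by (rule length_grow[OF cut])
  show ?thesis
  \<comment> \<open>The cut \<open>m\<close> itself falls under the first case: it stays in place
    and can be used again.\<close>
  proof (cases "m' \<le> m")
    case True
    have "set (crossing_lows m p) = {m - x..<m}"
      using cut mset_eq_setD[of "crossing_lows m p" "[m - x..<m]"] by (simp add: growable_at_def)
    then have "crossing_lows m' (grow m x p) = crossing_lows m' p"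
      using True by (intro crossing_lows_grow_below) auto
    then have "growable_at m' x' (grow m x p)"
      using m' len by (simp add: growable_at_def)
    then show ?thesis
      by (auto simp: growable_def)
  next
    case False
    have "mset (crossing_lows (m' + x) (grow m x p)) = image_mset (\<lambda>y. y + x) (mset [m' - x'..<m'])"
      using False m' by (simp add: crossing_lows_grow_above growable_at_def)
    also have "\<dots> = mset [m' + x - x'..<m' + x]"
      using m' unfolding mset_map[symmetric] map_add_const_upt by (simp add: growable_at_def)
    finally have "growable_at (m' + x) x' (grow m x p)"
      using m' len by (simp add: growable_at_def)
    then show ?thesis
      by (auto simp: growable_def)
  qed
qed

text \<open>Shifting leaves the gap \<open>[m..<m + x]\<close>, which the inserted vertices fill:
  they are the lower ends \<open>[m - x..<m]\<close> raised by \<open>x\<close>.\<close>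

lemma grow_permutation:
  assumes cut: "growable_at m x p" and perm: "mset p = mset [0..<length p]"
  shows "mset (grow m x p) = mset [0..<length (grow m x p)]"
proof -
  let ?v = "length p"
  have m: "x \<le> m" "m \<le> ?v"
    using cut by (auto simp: growable_at_def)
  have "map (shift_from m x) [0..<?v] = map (shift_from m x) [0..<m] @ map (shift_from m x) [m..<?v]"
    using m upt_split[of 0 m ?v] by simp
  also have "map (shift_from m x) [0..<m] = [0..<m]"
    by (rule map_idI) (simp add: shift_from_def)
  also have "map (shift_from m x) [m..<?v] = map (\<lambda>y. y + x) [m..<?v]"
    by (simp add: shift_from_def)
  finally have *: "map (shift_from m x) [0..<?v] = [0..<m] @ [m + x..<?v + x]"
    by (simp only: map_add_const_upt)
  have "mset (grow m x p) =
      mset (map (shift_from m x) [0..<?v]) + mset (map (\<lambda>y. y + x) [m - x..<m])"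
    using cut perm by (simp add: mset_grow growable_at_def)
  also have "\<dots> = mset ([0..<m] @ [m..<m + x] @ [m + x..<?v + x])"
    using m unfolding * map_add_const_upt by simp
  also have "[0..<m] @ [m..<m + x] @ [m + x..<?v + x] = [0..<?v + x]"
    using m upt_split[of m "m + x" "?v + x"] upt_split[of 0 m "?v + x"] by simp
  finally show ?thesis
    by (simp only: length_grow[OF cut])
qed

text \<open>Differences are linear rather than cyclic, so they do not change meaning when the vertex
  set is enlarged. The set \<open>X\<close> records which growth steps remain available.\<close>

definition realizes :: "nat set \<Rightarrow> nat multiset \<Rightarrow> bool" where
  "realizes X L \<longleftrightarrow>
     (\<exists>p. mset p = mset [0..<length p] \<and> mset (diffs p) = L \<and> (\<forall>x \<in> X. growable x p))"

lemma realizes_mono: "realizes X L \<Longrightarrow> Y \<subseteq> X \<Longrightarrow> realizes Y L"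
  unfolding realizes_def by blast

lemma realizes_grow:
  assumes "realizes X L" and "x \<in> X"
  shows "realizes X (L + replicate_mset x x)"
proof -
  obtain p where p: "mset p = mset [0..<length p]" "mset (diffs p) = L" "\<forall>x \<in> X. growable x p"
    using assms(1) by (auto simp: realizes_def)
  obtain m where m: "growable_at m x p"
    using p(3) assms(2) by (auto simp: growable_def)
  have "length (crossing_lows m p) = x"
    using m mset_eq_length[of "crossing_lows m p" "[m - x..<m]"] by (simp add: growable_at_def)
  then have "mset (diffs (grow m x p)) = L + replicate_mset x x"
    using p(2) by (simp add: mset_diffs_grow)
  then show ?thesis
    unfolding realizes_def
    using grow_permutation[OF m p(1)] growable_grow[OF m] p(3) by blast
qed

subsection \<open>From consecutive differences to Hamiltonian paths\<close>

lemma path_edges_Nil [simp]: "path_edges [] = {}"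
  and path_edges_singleton [simp]: "path_edges [y] = {}"
  by (auto simp: path_edges_def)

lemma path_edges_Cons_Cons [simp]:
  "path_edges (y # z # p) = insert {y, z} (path_edges (z # p))"
proof -
  have "{{(y # z # p) ! i, (y # z # p) ! Suc i} | i. Suc i < length (y # z # p)} =
      (\<lambda>i. {(y # z # p) ! i, (y # z # p) ! Suc i}) ` {..<Suc (length p)}"
    by auto
  also have "\<dots> = insert {y, z} ((\<lambda>i. {(z # p) ! i, (z # p) ! Suc i}) ` {..<length p})"
    by (simp only: lessThan_Suc_eq_insert_0 image_insert image_image nth_Cons_0 nth_Cons_Suc)
  also have "(\<lambda>i. {(z # p) ! i, (z # p) ! Suc i}) ` {..<length p} = path_edges (z # p)"
    by (auto simp: path_edges_def)
  finally show ?thesis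
    by (simp only: path_edges_def)
qed

lemma finite_path_edges [simp]: "finite (path_edges p)"
  by (induction p rule: diffs.induct) auto

lemma path_edges_subset: "e \<in> path_edges p \<Longrightarrow> e \<subseteq> set p"
  by (induction p rule: diffs.induct) auto

lemma path_edges_complete:
  "distinct p \<Longrightarrow> set p \<subseteq> {..<v} \<Longrightarrow> path_edges p \<subseteq> complete_edges v"
  by (induction p rule: diffs.induct) (auto simp: complete_edges_def)

text \<open>A difference of at most half of \<open>v\<close> attains the minimum in the cyclic
  length.\<close>

lemma edge_length_eq_absdiff:
  assumes "2 * absdiff y z \<le> v"
  shows "edge_length v {y, z} = absdiff y z"
  using assms by (cases "y \<le> z") (auto simp: edge_length_def absdiff_def max_def min_def)

lemma lengths_path_edges:
  assumes "distinct p" and "\<forall>x \<in> set (diffs p). 2 * x \<le> v"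
  shows "lengths v (path_edges p) = mset (diffs p)"
  using assms
proof (induction p rule: diffs.induct)
  case (1 y z p)
  \<comment> \<open>By distinctness \<open>y\<close> does not occur in \<open>z # p\<close>. Hence
    the edge is new, and passing to a set of edges loses no multiplicity.\<close>
  have "{y, z} \<notin> path_edges (z # p)"
    using 1(2) path_edges_subset by fastforce
  then show ?case
    using 1 by (simp add: lengths_def edge_length_eq_absdiff)
qed (auto simp: lengths_def)

lemma hamiltonian_path_if_realizes:
  assumes "realizes X L" and "v = size L + 1" and "\<forall>x \<in># L. 2 * x \<le> v"
  shows "\<exists>p. hamiltonian_path (complete_vertices v) (complete_edges v) p \<and>
             lengths v (path_edges p) = L"
proof -
  obtain p where p: "mset p = mset [0..<length p]" "mset (diffs p) = L"
    using assms(1) by (auto simp: realizes_def)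
  show ?thesis
  proof (cases "p = []")
    case True
    \<comment> \<open>The empty list also realizes the empty multiset, but the path must have one vertex.\<close>
    then have "L = {#}" "v = 1"
      using p assms(2) by auto
    then show ?thesis
      by (intro exI[of _ "[0]"])
        (auto simp: hamiltonian_path_def complete_vertices_def lengths_def)
  next
    case False
    have "length (diffs q) = length q - 1" for q
      by (induction q rule: diffs.induct) auto
    then have "length p = v"
      using False p(2) assms(2) by (metis Suc_eq_plus1 Suc_pred' length_greater_0_conv size_mset)
    then have "distinct p" "set p = {..<v}"
      using p(1) mset_eq_imp_distinct_iff[of p "[0..<v]"] mset_eq_setD[of p "[0..<v]"]
      by (auto simp: atLeast0LessThan)
    moreover have "\<forall>x \<in> set (diffs p). 2 * x \<le> v"
      using p(2) assms(3) by auto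
    ultimately show ?thesis
      using p(2) path_edges_complete[of p v] lengths_path_edges[of p v]
      by (intro exI[of _ p]) (simp add: hamiltonian_path_def complete_vertices_def)
  qed
qed

subsection \<open>The seeds\<close>

text \<open>
  An entry \<open>(a, b, c, d, X, p)\<close> says that \<open>p\<close> has differences \<open>{1^a, 2^b, 3^c, 4^d}\<close> and is
  growable by each \<open>x\<close> in \<open>X\<close>.
\<close>

definition seeds :: "(nat \<times> nat \<times> nat \<times> nat \<times> nat list \<times> nat list) list" where
  "seeds = [
   (2, 0, 1, 1, [1, 3], [0, 4, 1, 2, 3]),
   (2, 0, 1, 2, [1, 2, 4], [0, 4, 3, 2, 5, 1]),
   (2, 0, 1, 3, [1, 3, 4], [0, 4, 5, 1, 2, 6, 3]),
   (2, 0, 1, 5, [1, 3, 4], [0, 4, 8, 5, 1, 2, 6, 7, 3]),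
   (2, 0, 2, 2, [1, 3, 4], [0, 3, 6, 2, 1, 5, 4]),
   (2, 0, 2, 4, [1, 3, 4], [0, 3, 7, 6, 2, 1, 5, 8, 4]),
   (2, 0, 3, 1, [1, 3, 4], [0, 4, 1, 2, 5, 6, 3]),
   (2, 0, 3, 2, [1, 3, 4], [0, 3, 7, 4, 1, 2, 6, 5]),
   (2, 0, 3, 3, [1, 3, 4], [0, 3, 7, 6, 2, 1, 4, 8, 5]),
   (2, 0, 4, 2, [1, 3, 4], [0, 3, 6, 2, 1, 5, 8, 7, 4]),
   (2, 1, 1, 1, [2, 3], [2, 4, 3, 0, 1, 5]),
   (2, 1, 1, 2, [1, 2, 4], [0, 2, 6, 3, 4, 5, 1]),
   (2, 1, 1, 3, [2, 3, 4], [2, 5, 1, 0, 4, 6, 7, 3]),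
   (2, 1, 1, 4, [1, 2, 4], [0, 2, 6, 7, 3, 4, 8, 5, 1]),
   (2, 1, 1, 5, [2, 3, 4], [2, 6, 8, 9, 5, 1, 0, 4, 7, 3]),
   (2, 1, 2, 1, [2, 3], [2, 4, 5, 1, 0, 3, 6]),
   (2, 1, 2, 2, [2, 3, 4], [2, 5, 1, 0, 3, 7, 6, 4]),
   (2, 1, 2, 3, [2, 3, 4], [2, 3, 7, 4, 0, 1, 5, 8, 6]),
   (2, 1, 2, 4, [2, 3, 4], [2, 4, 8, 7, 3, 0, 1, 5, 9, 6]),
   (2, 1, 2, 5, [2, 3, 4], [2, 3, 7, 10, 8, 4, 0, 1, 5, 9, 6]),
   (2, 1, 3, 1, [1, 2, 3, 4], [0, 4, 1, 2, 5, 7, 6, 3]),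
   (2, 1, 3, 2, [2, 3, 4], [2, 5, 1, 0, 4, 7, 8, 6, 3]),
   (2, 1, 3, 3, [1, 2, 3, 4], [0, 4, 7, 9, 8, 5, 1, 2, 6, 3]),
   (2, 1, 3, 4, [2, 3, 4], [2, 3, 6, 9, 5, 1, 0, 4, 8, 10, 7]),
   (2, 1, 4, 2, [1, 2, 3, 4], [0, 3, 6, 2, 1, 5, 8, 9, 7, 4]),
   (2, 1, 4, 4, [1, 2, 3, 4], [0, 3, 7, 10, 11, 9, 6, 2, 1, 5, 8, 4]),
   (2, 2, 1, 1, [1, 2, 3], [0, 4, 6, 5, 2, 1, 3]),
   (2, 2, 1, 2, [1, 2, 3, 4], [0, 4, 2, 1, 5, 7, 6, 3]),
   (2, 2, 1, 3, [1, 2, 3, 4], [0, 4, 7, 8, 6, 2, 1, 5, 3]),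
   (2, 2, 1, 4, [1, 2, 3, 4], [0, 4, 6, 2, 1, 5, 8, 9, 7, 3]),
   (2, 2, 1, 5, [1, 2, 3, 4], [0, 4, 8, 10, 9, 6, 2, 1, 5, 7, 3]),
   (2, 2, 2, 1, [1, 2, 3], [0, 3, 5, 7, 6, 2, 1, 4]),
   (2, 2, 2, 2, [1, 2, 3, 4], [0, 3, 5, 1, 2, 6, 8, 7, 4]),
   (2, 2, 2, 3, [1, 2, 3, 4], [0, 3, 6, 2, 1, 5, 7, 9, 8, 4]),
   (2, 2, 2, 4, [1, 2, 3, 4], [0, 3, 7, 5, 1, 2, 6, 9, 10, 8, 4]),
   (2, 2, 2, 5, [1, 2, 3, 4], [0, 3, 7, 9, 11, 10, 6, 2, 1, 5, 8, 4]),
   (2, 2, 3, 1, [1, 2, 3, 4], [0, 4, 1, 2, 5, 7, 8, 6, 3]),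
   (2, 2, 3, 2, [1, 2, 3, 4], [0, 3, 6, 2, 1, 4, 8, 9, 7, 5]),
   (2, 2, 3, 3, [1, 2, 3, 4], [0, 3, 7, 4, 1, 2, 6, 8, 10, 9, 5]),
   (2, 2, 3, 4, [1, 2, 3, 4], [0, 3, 2, 6, 8, 4, 1, 5, 9, 11, 10, 7]),
   (3, 0, 0, 4, [1, 3, 4], [0, 4, 5, 1, 2, 6, 7, 3]),
   (3, 0, 1, 4, [1, 3, 4], [0, 4, 8, 5, 1, 2, 3, 7, 6]),
   (3, 0, 2, 1, [1, 3], [0, 3, 4, 1, 2, 6, 5]),
   (3, 0, 2, 3, [1, 3, 4], [0, 3, 7, 8, 4, 1, 2, 6, 5]),
   (3, 0, 2, 5, [1, 3, 4], [0, 3, 2, 6, 10, 9, 5, 1, 4, 8, 7]),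
   (3, 1, 0, 4, [1, 2, 3, 4], [0, 4, 5, 1, 2, 6, 8, 7, 3]),
   (3, 1, 1, 1, [1, 2, 3], [0, 3, 2, 1, 5, 6, 4]),
   (3, 1, 1, 3, [1, 2, 3, 4], [0, 3, 7, 8, 6, 2, 1, 5, 4]),
   (3, 1, 1, 5, [1, 2, 3, 4], [0, 3, 7, 6, 2, 1, 5, 9, 10, 8, 4]),
   (3, 1, 2, 1, [1, 2, 3], [0, 3, 4, 1, 2, 6, 7, 5]),
   (3, 1, 2, 2, [1, 2, 3, 4], [0, 4, 2, 1, 5, 8, 7, 6, 3]),
   (3, 1, 2, 3, [1, 2, 3, 4], [0, 3, 7, 9, 8, 4, 1, 2, 6, 5]),
   (3, 1, 2, 4, [1, 2, 3, 4], [0, 3, 7, 6, 2, 1, 4, 8, 10, 9, 5]),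
   (3, 1, 2, 5, [1, 2, 3, 4], [0, 3, 2, 6, 10, 11, 9, 5, 1, 4, 8, 7]),
   (3, 1, 3, 2, [1, 2, 3, 4], [0, 3, 1, 2, 5, 9, 6, 7, 8, 4])]"

section \<open>Checking the seeds by evaluation\<close>

definition list1234 :: "nat \<Rightarrow> nat \<Rightarrow> nat \<Rightarrow> nat \<Rightarrow> nat multiset" where
  "list1234 a b c d =
     replicate_mset a 1 + replicate_mset b 2 + replicate_mset c 3 + replicate_mset d 4"

text \<open>Sorting turns multiset equations into list equations that can be evaluated, and a finite
  range of cuts makes the search for \<open>m\<close> executable.\<close>

definition valid_seed :: "nat \<times> nat \<times> nat \<times> nat \<times> nat list \<times> nat list \<Rightarrow> bool" where
  "valid_seed = (\<lambda>(a, b, c, d, X, p).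
     sort p = [0..<length p] \<and>
     sort (diffs p) = replicate a 1 @ replicate b 2 @ replicate c 3 @ replicate d 4 \<and>
     list_all (\<lambda>x. list_ex (\<lambda>m. sort (crossing_lows m p) = [m - x..<m]) [x..<length p]) X)"

lemma realizes_if_valid_seed:
  assumes "valid_seed (a, b, c, d, X, p)"
  shows "realizes (set X) (list1234 a b c d)"
proof -
  have mset_eq: "mset xs = mset ys" if "sort xs = ys" for xs ys :: "nat list"
    using that mset_sort by metis
  have "mset p = mset [0..<length p]"
    using assms by (intro mset_eq) (simp add: valid_seed_def)
  moreover have
    "mset (diffs p) = mset (replicate a 1 @ replicate b 2 @ replicate c 3 @ replicate d 4)"
    using assms by (intro mset_eq) (simp add: valid_seed_def)
  then have "mset (diffs p) = list1234 a b c d"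
    by (simp add: list1234_def)
  moreover have "growable x p" if x: "x \<in> set X" for x
  proof -
    obtain m where "x \<le> m" "m < length p" and sort: "sort (crossing_lows m p) = [m - x..<m]"
      using assms x by (fastforce simp: valid_seed_def list_all_iff list_ex_iff)
    moreover have "mset (crossing_lows m p) = mset [m - x..<m]"
      using sort by (rule mset_eq)
    ultimately have "growable_at m x p"
      by (simp add: growable_at_def)
    then show ?thesis
      by (auto simp: growable_def)
  qed
  ultimately show ?thesis
    unfolding realizes_def by blast
qed

lemma valid_seeds: "list_all valid_seed seeds"
  by code_simp

text \<open>
  Growth by each \<open>x\<close> is only demanded once \<open>x\<close> occurs more often than in the smallest lists,
  because, for instance, \<open>{1^2, 2, 3, 4}\<close> has no linear realization growable by 4.
\<close>

definition growth_demand :: "nat \<Rightarrow> nat \<Rightarrow> nat \<Rightarrow> nat \<Rightarrow> nat list" where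
  "growth_demand a b c d =
     (if 2 < a then [1] else []) @ (if 0 < b then [2] else []) @
     (if 1 < c then [3] else []) @ (if 1 < d then [4] else [])"

text \<open>At most one growth by \<open>x\<close> is allowed, so one seed can serve several members
  of the box.\<close>

definition reaches :: "nat \<Rightarrow> nat list \<Rightarrow> nat \<Rightarrow> nat \<Rightarrow> bool" where
  "reaches x X n n' \<longleftrightarrow> n' = n \<or> n' = n + x \<and> x \<in> set X"

text \<open>Each upper bound is the largest count from which the induction cannot yet remove
  \<open>x\<close> copies of \<open>x\<close> while keeping the growth demand unchanged.\<close>

definition box :: "(nat \<times> nat \<times> nat \<times> nat) list" where
  "box = [(a, b, c, d). a \<leftarrow> [2, 3], b \<leftarrow> [0, 1, 2], c \<leftarrow> [1, 2, 3, 4], d \<leftarrow> [1, 2, 3, 4, 5]]"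

text \<open>The excluded pair is the one outside the scope of the theorem; seeds with that pair
  serve only after a growth by 1 or 2.\<close>

lemma seeds_reach_box:
  "list_all (\<lambda>(a, b, c, d). a = 2 \<and> b = 0 \<or>
     list_ex (\<lambda>(a', b', c', d', X, p).
       reaches 1 X a' a \<and> reaches 2 X b' b \<and> reaches 3 X c' c \<and> reaches 4 X d' d \<and>
       list_all (\<lambda>x. x \<in> set X) (growth_demand a b c d)) seeds) box"
  by code_simp

section \<open>From seeds to the box and on to all parameters\<close>

lemma list1234_add:
  "list1234 (a + 1) b c d = list1234 a b c d + replicate_mset 1 1"
  "list1234 a (b + 2) c d = list1234 a b c d + replicate_mset 2 2"
  "list1234 a b (c + 3) d = list1234 a b c d + replicate_mset 3 3"
  "list1234 a b c (d + 4) = list1234 a b c d + replicate_mset 4 4"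
  by (simp_all add: list1234_def numeral_eq_Suc)

lemma realizes_reaches:
  assumes "realizes (set X) (list1234 a' b' c' d')"
    and "reaches 1 X a' a" "reaches 2 X b' b" "reaches 3 X c' c" "reaches 4 X d' d"
  shows "realizes (set X) (list1234 a b c d)"
proof -
  have "realizes (set X) (list1234 a b' c' d')"
    using assms(1,2) realizes_grow[of "set X" _ 1] unfolding reaches_def by (metis list1234_add(1))
  then have "realizes (set X) (list1234 a b c' d')"
    using assms(3) realizes_grow[of "set X" _ 2] unfolding reaches_def by (metis list1234_add(2))
  then have "realizes (set X) (list1234 a b c d')"
    using assms(4) realizes_grow[of "set X" _ 3] unfolding reaches_def by (metis list1234_add(3))
  then show ?thesis
    using assms(5) realizes_grow[of "set X" _ 4] unfolding reaches_def by (metis list1234_add(4))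
qed

lemma realizes_box:
  assumes "(a, b, c, d) \<in> set box" and "a = 2 \<longrightarrow> b \<noteq> 0"
  shows "realizes (set (growth_demand a b c d)) (list1234 a b c d)"
proof -
  obtain a' b' c' d' X p where seed: "(a', b', c', d', X, p) \<in> set seeds"
    and reach: "reaches 1 X a' a" "reaches 2 X b' b" "reaches 3 X c' c" "reaches 4 X d' d"
    and demand: "set (growth_demand a b c d) \<subseteq> set X"
    using assms seeds_reach_box by (fastforce simp: list_all_iff list_ex_iff)
  have "realizes (set X) (list1234 a' b' c' d')"
    using seed valid_seeds by (intro realizes_if_valid_seed) (auto simp: list_all_iff)
  then show ?thesis
    using realizes_reaches reach demand realizes_mono by blast
qed

lemma mem_box:
  "(a, b, c, d) \<in> set box \<longleftrightarrow> a \<in> {2..3} \<and> b \<in> {0..2} \<and> c \<in> {1..4} \<and> d \<in> {1..5}"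
  unfolding box_def by (simp add: image_iff) presburger

text \<open>Induction on the number of edges: outside the box some \<open>x\<close> is frequent
  enough that removing \<open>x\<close> copies leaves the growth demand unchanged and still
  containing \<open>x\<close>, so one growth restores them.\<close>

lemma realizes_list1234:
  assumes "a \<ge> 3 \<or> a = 2 \<and> b \<ge> 1" and "c \<ge> 1" and "d \<ge> 1"
  shows "realizes (set (growth_demand a b c d)) (list1234 a b c d)"
  using assms
proof (induction "a + b + c + d" arbitrary: a b c d rule: less_induct)
  case less
  consider "a \<ge> 4" | "b \<ge> 3" | "c \<ge> 5" | "d \<ge> 6" | "a \<le> 3" "b \<le> 2" "c \<le> 4" "d \<le> 5"
    by linarith
  then show ?case
  proof cases
    case 1
    then obtain a' where a': "a = a' + 1" "a' \<ge> 3"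
      by (intro that[of "a - 1"]) auto
    then have "realizes (set (growth_demand a' b c d)) (list1234 a' b c d)"
      using less by (intro less(1)) auto
    moreover have "growth_demand a' b c d = growth_demand a b c d" "1 \<in> set (growth_demand a b c d)"
      using a' by (auto simp: growth_demand_def)
    ultimately show ?thesis
      using realizes_grow[of _ "list1234 a' b c d" 1] a'(1) by (metis list1234_add(1))
  next
    case 2
    \<comment> \<open>Keeping \<open>b'\<close> positive preserves both the demand for growth by 2
      and the hypothesis when \<open>a = 2\<close>.\<close>
    then obtain b' where b': "b = b' + 2" "b' \<ge> 1"
      by (intro that[of "b - 2"]) auto
    then have "realizes (set (growth_demand a b' c d)) (list1234 a b' c d)"
      using less by (intro less(1)) auto
    moreover have "growth_demand a b' c d = growth_demand a b c d" "2 \<in> set (growth_demand a b c d)"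
      using b' by (auto simp: growth_demand_def)
    ultimately show ?thesis
      using realizes_grow[of _ "list1234 a b' c d" 2] b'(1) by (metis list1234_add(2))
  next
    case 3
    then obtain c' where c': "c = c' + 3" "c' \<ge> 2"
      by (intro that[of "c - 3"]) auto
    then have "realizes (set (growth_demand a b c' d)) (list1234 a b c' d)"
      using less by (intro less(1)) auto
    moreover have "growth_demand a b c' d = growth_demand a b c d" "3 \<in> set (growth_demand a b c d)"
      using c' by (auto simp: growth_demand_def)
    ultimately show ?thesis
      using realizes_grow[of _ "list1234 a b c' d" 3] c'(1) by (metis list1234_add(3))
  next
    case 4
    then obtain d' where d': "d = d' + 4" "d' \<ge> 2"
      by (intro that[of "d - 4"]) auto
    then have "realizes (set (growth_demand a b c d')) (list1234 a b c d')"
      using less by (intro less(1)) auto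
    moreover have "growth_demand a b c d' = growth_demand a b c d" "4 \<in> set (growth_demand a b c d)"
      using d' by (auto simp: growth_demand_def)
    ultimately show ?thesis
      using realizes_grow[of _ "list1234 a b c d'" 4] d'(1) by (metis list1234_add(4))
  next
    case 5
    then show ?thesis
      using less.prems by (intro realizes_box) (auto simp: mem_box)
  qed
qed

theorem theorem1p8:
  fixes a b c d v :: nat and L :: "nat multiset"
  assumes "c \<ge> 1" and "d \<ge> 1"
    and "v = a + b + c + d + 1"
    and "L = replicate_mset a 1 + replicate_mset b 2 + replicate_mset c 3 + replicate_mset d 4"
    and "admissible v L"
    and "a \<ge> 3 \<or> (a = 2 \<and> b \<ge> 1)"
  shows "\<exists>p. hamiltonian_path (complete_vertices v) (complete_edges v) p \<and>
             lengths v (path_edges p) = L"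
proof (rule hamiltonian_path_if_realizes)
  show "realizes (set (growth_demand a b c d)) L"
    using realizes_list1234[OF assms(6,1,2)] assms(4) by (simp add: list1234_def)
  show "v = size L + 1"
    using assms(3,4) by simp
  \<comment> \<open>Admissibility bounds each length by \<open>v div 2\<close>.\<close>
  show "\<forall>x \<in># L. 2 * x \<le> v"
    using assms(5) by (auto simp: admissible_def)
qed

end
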